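(* For each $n\in\mathbb{N}$ let $F_n\in\mathcal{C}^3(\mathbb{R})$ be a real-valued concave function having a unique absolute maximum at $x_n\in\mathbb{R}$ and such that $F_n''(x_n)<0$. Suppose that there exists a sequence $(r_n)_{n\in\mathbb{N}}$ of positive reals such that for $$\sigma_n:=\sqrt{\frac{1}{-F_n''(x_n)}}\qquad\text{and}\qquad\eta_n:=\sup\left\{|F_n'''(\xi)|:\xi\in(x_n-r_n,x_n+r_n)\right\}$$ we have, as $n\to\infty$, $$\frac{r_n}{\sigma_n}\to\infty\qquad\text{and}\qquad\delta_n:=\sigma_n^2r_n\eta_n\to0.$$ Let $I\subset\mathbb{R}$ be an interval such that $(x_n-r_n,x_n+r_n)\subset I$ for all sufficiently large $n\in\mathbb{N}$. Then, as $n\to\infty$, $$\int_I e^{F_n(x)}\,dx\sim\sqrt{\frac{2\pi}{-F_n''(x_n)}}\;e^{F_n(x_n)}.$$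
   Context: For positive sequences, $a_n\sim b_n$ means $\lim_{n\to\infty}a_n/b_n=1$. *)

theory Defs
  imports "HOL-Analysis.Analysis" "HOL-Library.Landau_Symbols"
begin

(* C^k on the whole real line. Differentiability of the lower iterates is required
   explicitly, as deriv is an arbitrary value at points of non-differentiability. *)
definition Ck_real :: "nat \<Rightarrow> (real \<Rightarrow> real) \<Rightarrow> bool" where
  "Ck_real k f \<longleftrightarrow>
     (\<forall>j<k. \<forall>x. (deriv ^^ j) f differentiable (at x)) \<and> continuous_on UNIV ((deriv ^^ k) f)"

end

theory Submission
  imports Defs "HOL-Probability.Distributions" "HOL-Probability.Sinc_Integral"
begin

text \<open>
  Measured in units of \<open>\<sigma>\<^sub>n\<close> around the maximum, the function
  \<open>g\<^sub>n u = F\<^sub>n (x\<^sub>n + \<sigma>\<^sub>n u) - F\<^sub>n (x\<^sub>n)\<close> has second derivative \<open>-1\<close> at \<open>0\<close>, and a third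
  order Taylor expansion gives \<open>\<bar>g\<^sub>n u + u\<^sup>2/2\<bar> \<le> \<delta>\<^sub>n u\<^sup>2/6\<close> for \<open>\<bar>u\<bar> < r\<^sub>n/\<sigma>\<^sub>n\<close>: one of the three
  factors \<open>\<bar>u\<bar>\<close> in the cubic remainder is traded for \<open>r\<^sub>n/\<sigma>\<^sub>n\<close>. As \<open>\<delta>\<^sub>n \<rightarrow> 0\<close> and
  \<open>r\<^sub>n/\<sigma>\<^sub>n \<rightarrow> \<infinity>\<close>, \<open>g\<^sub>n u\<close> tends to \<open>-u\<^sup>2/2\<close> for every \<open>u\<close>, and the substitution turns the claim
  into \<open>\<integral> exp (g\<^sub>n u) du \<rightarrow> \<integral> exp (-u\<^sup>2/2) du = sqrt (2 pi)\<close>.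

  The tails are controlled by concavity. Once \<open>\<delta>\<^sub>n \<le> 1 < r\<^sub>n/\<sigma>\<^sub>n\<close>, the estimate gives
  \<open>g\<^sub>n (\<plusminus>1) \<le> -1/3\<close>, and a concave function that vanishes at \<open>0\<close> stays below its chords
  from \<open>0\<close> after they end, so \<open>g\<^sub>n u \<le> -\<bar>u\<bar>/3\<close> for \<open>\<bar>u\<bar> \<ge> 1\<close>. This gives an integrable bound
  that does not depend on \<open>n\<close> (lemma \<open>concave_linear_decay\<close>), and dominated convergence
  applies on the whole line at once (lemma \<open>rescaled_laplace_limit\<close>).
\<close>

lemma Ck_real_has_real_derivative:
  assumes "Ck_real k f" "j < k"
  shows "((deriv ^^ j) f has_real_derivative (deriv ^^ Suc j) f t) (at t)"
  using assms by (simp add: Ck_real_def DERIV_deriv_iff_real_differentiable)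

lemma taylor_quadratic_remainder:
  fixes f :: "real \<Rightarrow> real"
  assumes C3: "Ck_real 3 f" and crit: "deriv f c = 0" and y: "\<bar>y - c\<bar> < r"
  shows "\<bar>f y - f c - (deriv ^^ 2) f c / 2 * (y - c)\<^sup>2\<bar>
    \<le> (SUP \<xi>\<in>{c - r<..<c + r}. \<bar>(deriv ^^ 3) f \<xi>\<bar>) / 6 * \<bar>y - c\<bar> ^ 3"
proof (cases "y = c")
  case False
  have "\<exists>t. (if y < c then y < t \<and> t < c else c < t \<and> t < y) \<and>
      f y = (\<Sum>m<3. ((deriv ^^ m) f c / fact m) * (y - c) ^ m) + ((deriv ^^ 3) f t / fact 3) * (y - c) ^ 3"
    by (rule Taylor[where diff = "\<lambda>m. (deriv ^^ m) f" and a = "min y c" and b = "max y c"])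
      (use False Ck_real_has_real_derivative[OF C3] in auto)
  then obtain t where t: "if y < c then y < t \<and> t < c else c < t \<and> t < y"
    and fy: "f y = (\<Sum>m<3. ((deriv ^^ m) f c / fact m) * (y - c) ^ m) + ((deriv ^^ 3) f t / fact 3) * (y - c) ^ 3"
    by blast
  have tr: "t \<in> {c - r<..<c + r}"
    using t y by (auto split: if_splits)
  have "continuous_on {c - r..c + r} (\<lambda>\<xi>. \<bar>(deriv ^^ 3) f \<xi>\<bar>)"
    using C3 unfolding Ck_real_def
    by (intro continuous_on_rabs) (meson continuous_on_subset subset_UNIV)
  \<comment> \<open>The supremum of an unbounded set is an arbitrary value; compactness of the closed
    interval rules this out.\<close>
  then have "bdd_above ((\<lambda>\<xi>. \<bar>(deriv ^^ 3) f \<xi>\<bar>) ` {c - r..c + r})"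
    by (intro bounded_imp_bdd_above compact_imp_bounded compact_continuous_image compact_Icc)
  then have "bdd_above ((\<lambda>\<xi>. \<bar>(deriv ^^ 3) f \<xi>\<bar>) ` {c - r<..<c + r})"
    by (rule bdd_above_mono) auto
  then have sup: "\<bar>(deriv ^^ 3) f t\<bar> \<le> (SUP \<xi>\<in>{c - r<..<c + r}. \<bar>(deriv ^^ 3) f \<xi>\<bar>)"
    using tr by (intro cSUP_upper)
  have set3: "{..<3::nat} = {0, 1, 2}" by auto
  have "f y - f c - (deriv ^^ 2) f c / 2 * (y - c)\<^sup>2 = (deriv ^^ 3) f t / 6 * (y - c) ^ 3"
    using fy crit by (simp add: set3 fact_numeral)
  also have "\<bar>\<dots>\<bar> = \<bar>(deriv ^^ 3) f t\<bar> / 6 * \<bar>y - c\<bar> ^ 3"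
    by (simp add: abs_mult power_abs)
  also have "\<dots> \<le> (SUP \<xi>\<in>{c - r<..<c + r}. \<bar>(deriv ^^ 3) f \<xi>\<bar>) / 6 * \<bar>y - c\<bar> ^ 3"
    using sup by (intro mult_right_mono) auto
  finally show ?thesis .
qed simp

text \<open>
  Closeness to \<open>-u\<^sup>2/2\<close> is only known on a bounded interval; concavity propagates the value at
  \<open>\<plusminus>1\<close> linearly to all larger \<open>\<bar>u\<bar>\<close>. The constant \<open>1/3\<close> is \<open>1/2 - 1/6\<close>, and the additive shift
  makes the bound valid on \<open>[-1, 1]\<close> too, where \<open>g \<le> 0\<close>.
\<close>
lemma concave_linear_decay:
  fixes g :: "real \<Rightarrow> real"
  assumes conc: "concave_on UNIV g" and near: "\<And>u. \<bar>u\<bar> < R \<Longrightarrow> \<bar>g u + u\<^sup>2 / 2\<bar> \<le> d * u\<^sup>2 / 6"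
    and R: "R > 1" and d: "d \<le> 1"
  shows "g u \<le> 1/3 - \<bar>u\<bar> / 3"
proof -
  have le: "g v \<le> - (v\<^sup>2 / 3)" if "\<bar>v\<bar> < R" for v
    using near[OF that] mult_right_mono[OF d zero_le_power2, of v] by linarith
  show ?thesis
  proof (cases "\<bar>u\<bar> \<le> 1")
    case True
    with le[of u] R have "g u \<le> - (u\<^sup>2 / 3)" by simp
    also have "\<dots> \<le> 0" by simp
    finally show ?thesis using True by simp
  next
    case False
    define s where "s = 1 / \<bar>u\<bar>"
    have s: "0 \<le> s" "s \<le> 1" and u: "u \<noteq> 0" using False by (auto simp: s_def)
    have g0: "g 0 = 0" using near[of 0] R by simp
    have su: "s * u = sgn u" using u by (simp add: s_def sgn_real_def abs_if)
    have "s * g u \<le> g (s * u)"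
      using concave_onD[OF conc s, of 0 u] g0 by simp
    also have "\<dots> \<le> - (1/3)"
      using le[of 1] le[of "- 1"] R u unfolding su by (simp add: sgn_if)
    finally have "g u \<le> - \<bar>u\<bar> / 3"
      using False by (simp add: s_def field_simps)
    then show ?thesis by simp
  qed
qed

lemma integrable_exp_minus_abs:
  fixes a :: real
  assumes "a > 0"
  shows "integrable lborel (\<lambda>u. exp (- (a * \<bar>u\<bar>)))"
proof -
  let ?h = "\<lambda>u::real. indicator {0<..} u * exp (- (u * a))"
  have h: "integrable lborel ?h"
    using integrable_I0i_exp_mscale[OF assms] by (simp add: set_integrable_def)
  then have "integrable lborel (\<lambda>u. ?h (0 + (-1) * u))"
    by (intro lborel_integrable_real_affine) auto
  with h have "integrable lborel (\<lambda>u. ?h u + ?h (- u))"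
    by (intro Bochner_Integration.integrable_add) auto
  \<comment> \<open>At \<open>0\<close> the two halves sum to \<open>0\<close> and not to \<open>1\<close>.\<close>
  moreover have "AE u in lborel. ?h u + ?h (- u) = exp (- (a * \<bar>u\<bar>))"
    using AE_lborel_singleton[of 0]
    by eventually_elim (auto simp: indicator_def abs_if mult_ac)
  ultimately show ?thesis
    using integrable_cong_AE_imp[of lborel "\<lambda>u. ?h u + ?h (- u)" "\<lambda>u. exp (- (a * \<bar>u\<bar>))"]
    by simp
qed

lemma integral_exp_minus_half_square:
  "(LINT u|lborel. exp (- u\<^sup>2 / 2)) = sqrt (2 * pi)"
  using integral_std_normal_moment_even[of 0] by (simp add: std_normal_density_def)

text \<open>
  Laplace's method in normalised form. The rescaled domains of integration \<open>A n\<close> exhaust the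
  line, so their indicators tend to \<open>1\<close> pointwise, and the bound from
  \<open>concave_linear_decay\<close> dominates the integrands for all large \<open>n\<close>; dropping finitely many
  terms of the sequence makes this a bound for every \<open>n\<close>.
\<close>
lemma rescaled_laplace_limit:
  fixes g :: "nat \<Rightarrow> real \<Rightarrow> real" and R d :: "nat \<Rightarrow> real"
  assumes A: "\<And>n. A n \<in> sets borel" and conc: "\<And>n. concave_on UNIV (g n)"
    and near: "\<And>n u. \<bar>u\<bar> < R n \<Longrightarrow> \<bar>g n u + u\<^sup>2 / 2\<bar> \<le> d n * u\<^sup>2 / 6"
    and R: "filterlim R at_top sequentially" and d: "d \<longlonglongrightarrow> 0"
    and sub: "\<forall>\<^sub>F n in sequentially. {- R n<..<R n} \<subseteq> A n"
  shows "(\<lambda>n. LINT u:A n|lborel. exp (g n u)) \<longlonglongrightarrow> sqrt (2 * pi)"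
proof -
  have "\<forall>\<^sub>F n in sequentially. R n > 1 \<and> d n \<le> 1"
    using filterlim_at_top_dense[THEN iffD1, OF R, rule_format, of 1] order_tendstoD(2)[OF d, of 1]
    by (auto elim: eventually_elim2)
  then obtain N where N: "\<And>n. n \<ge> N \<Longrightarrow> R n > 1 \<and> d n \<le> 1"
    by (auto simp: eventually_sequentially)
  let ?s = "\<lambda>n u. indicator (A n) u * exp (g n u)"
  have g_meas: "g n \<in> borel_measurable borel" for n
  proof -
    have "continuous_on UNIV (\<lambda>u. - g n u)"
      using conc[of n] by (intro convex_on_continuous) (auto simp: concave_on_def)
    then have "continuous_on UNIV (g n)"
      using continuous_on_minus by fastforce
    then show ?thesis by (rule borel_measurable_continuous_onI)
  qed
  have s_meas: "?s n \<in> borel_measurable lborel" for n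
    using A[of n] g_meas[of n] by measurable
  have pointwise: "(\<lambda>n. ?s n u) \<longlonglongrightarrow> exp (- u\<^sup>2 / 2)" for u
  proof -
    have large: "\<forall>\<^sub>F n in sequentially. \<bar>u\<bar> < R n"
      using R by (simp add: filterlim_at_top_dense)
    have "(\<lambda>n. g n u + u\<^sup>2 / 2) \<longlonglongrightarrow> 0"
    proof (rule Lim_null_comparison)
      show "\<forall>\<^sub>F n in sequentially. norm (g n u + u\<^sup>2 / 2) \<le> d n * u\<^sup>2 / 6"
        using large by eventually_elim (use near in simp)
      show "(\<lambda>n. d n * u\<^sup>2 / 6) \<longlonglongrightarrow> 0"
        using tendsto_mult_right[OF d, of "u\<^sup>2 / 6"] by (simp add: mult.commute)
    qed
    from tendsto_exp[OF tendsto_diff[OF this tendsto_const[of "u\<^sup>2 / 2"]]]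
    have "(\<lambda>n. exp (g n u)) \<longlonglongrightarrow> exp (- u\<^sup>2 / 2)" by simp
    moreover have "\<forall>\<^sub>F n in sequentially. exp (g n u) = ?s n u"
      using large sub by eventually_elim (auto simp: abs_less_iff subset_eq)
    ultimately show ?thesis by (rule Lim_transform_eventually)
  qed
  have bound: "norm (?s n u) \<le> exp (1/3) * exp (- (1/3 * \<bar>u\<bar>))" if "n \<ge> N" for n u
  proof -
    have "norm (?s n u) \<le> exp (g n u)" by (simp add: indicator_def)
    also have "\<dots> \<le> exp (1/3 + - (1/3 * \<bar>u\<bar>))"
      using concave_linear_decay[of "g n" "R n" "d n" u] conc near N[OF that] by simp
    finally show ?thesis by (simp only: exp_add)
  qed
  have "(\<lambda>n. LINT u|lborel. ?s (n + N) u) \<longlonglongrightarrow> (LINT u|lborel. exp (- u\<^sup>2 / 2))"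
  proof (rule integral_dominated_convergence)
    show "integrable lborel (\<lambda>u. exp (1/3) * exp (- (1/3 * \<bar>u\<bar>)) :: real)"
      by (intro integrable_mult_right integrable_exp_minus_abs) simp
  qed (use s_meas bound LIMSEQ_ignore_initial_segment[OF pointwise] in auto)
  then have "(\<lambda>n. LINT u|lborel. ?s n u) \<longlonglongrightarrow> (LINT u|lborel. exp (- u\<^sup>2 / 2))"
    by (rule LIMSEQ_offset)
  then show ?thesis
    by (simp add: set_lebesgue_integral_def flip: integral_exp_minus_half_square)
qed

lemma concave_on_rescale:
  fixes f :: "real \<Rightarrow> real"
  assumes "concave_on UNIV f"
  shows "concave_on UNIV (\<lambda>u. f (c + s * u) - b)"
  unfolding concave_on_iff
proof (intro conjI ballI allI impI)
  fix x y u v :: real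
  assume uv: "0 \<le> u" "0 \<le> v" "u + v = 1"
  have "u = 1 - v" using uv(3) by simp
  have "c + s * (u *\<^sub>R x + v *\<^sub>R y) = u *\<^sub>R (c + s * x) + v *\<^sub>R (c + s * y)"
    and "u * (f (c + s * x) - b) + v * (f (c + s * y) - b) = u * f (c + s * x) + v * f (c + s * y) - b"
    unfolding \<open>u = 1 - v\<close> by (simp_all add: algebra_simps)
  moreover have "u * f (c + s * x) + v * f (c + s * y) \<le> f (u *\<^sub>R (c + s * x) + v *\<^sub>R (c + s * y))"
    using assms uv unfolding concave_on_iff by blast
  ultimately show "u * (f (c + s * x) - b) + v * (f (c + s * y) - b)
      \<le> f (c + s * (u *\<^sub>R x + v *\<^sub>R y)) - b"
    by simp
qed simp

lemma set_integral_exp_rescale: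
  fixes f :: "real \<Rightarrow> real"
  assumes "s > 0"
  shows "(LINT t:I|lborel. exp (f t))
    = s * exp (f c) * (LINT u:{u. c + s * u \<in> I}|lborel. exp (f (c + s * u) - f c))"
proof -
  have "(LINT t:I|lborel. exp (f t))
      = s * (LINT u|lborel. indicator I (c + s * u) * exp (f (c + s * u)))"
    using lborel_integral_real_affine[of s "\<lambda>t. indicator I t * exp (f t)" c] assms
    by (simp add: set_lebesgue_integral_def)
  also have "(\<lambda>u. indicator I (c + s * u) * exp (f (c + s * u)))
      = (\<lambda>u. exp (f c) * (indicator {u. c + s * u \<in> I} u * exp (f (c + s * u) - f c)))"
    by (auto simp: fun_eq_iff indicator_def exp_diff)
  finally show ?thesis by (simp add: set_lebesgue_integral_def)
qed

theorem proposition8: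
  fixes F :: "nat \<Rightarrow> real \<Rightarrow> real"
    and x r \<sigma> \<eta> \<delta> :: "nat \<Rightarrow> real"
    and I :: "real set"
  assumes "\<And>n. Ck_real 3 (F n)"
    and "\<And>n. concave_on UNIV (F n)"
    and "\<And>n y. is_arg_max (F n) (\<lambda>_. True) y \<longleftrightarrow> y = x n"
    and "\<And>n. (deriv ^^ 2) (F n) (x n) < 0"
    and "\<And>n. r n > 0"
    and "\<And>n. \<sigma> n = sqrt (1 / (- (deriv ^^ 2) (F n) (x n)))"
    and "\<And>n. \<eta> n = (SUP \<xi>\<in>{x n - r n<..<x n + r n}. \<bar>(deriv ^^ 3) (F n) \<xi>\<bar>)"
    and "\<And>n. \<delta> n = (\<sigma> n)\<^sup>2 * r n * \<eta> n"
    and "filterlim (\<lambda>n. r n / \<sigma> n) at_top sequentially"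
    and "\<delta> \<longlonglongrightarrow> 0"
    and "is_interval I"
    and "\<forall>\<^sub>F n in sequentially. {x n - r n<..<x n + r n} \<subseteq> I"
  shows "(\<lambda>n. LINT t:I|lborel. exp (F n t)) \<sim>[sequentially]
         (\<lambda>n. sqrt (2 * pi / (- (deriv ^^ 2) (F n) (x n))) * exp (F n (x n)))"
proof -
  let ?D2 = "\<lambda>n. (deriv ^^ 2) (F n) (x n)"
  define g where "g = (\<lambda>n u. F n (x n + \<sigma> n * u) - F n (x n))"
  define A where "A = (\<lambda>n. {u. x n + \<sigma> n * u \<in> I})"
  have \<sigma>_pos: "\<sigma> n > 0" for n
    using assms(4)[of n] by (simp add: assms(6) divide_neg_neg)
  have \<sigma>_sq: "?D2 n * (\<sigma> n)\<^sup>2 = - 1" for n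
    using assms(4)[of n] by (simp add: assms(6) divide_nonneg_neg divide_nonpos_neg)
  have crit: "deriv (F n) (x n) = 0" for n
  proof (rule DERIV_local_max)
    show "(F n has_real_derivative deriv (F n) (x n)) (at (x n))"
      using Ck_real_has_real_derivative[OF assms(1), of 0] by simp
    show "\<forall>y. \<bar>x n - y\<bar> < 1 \<longrightarrow> F n y \<le> F n (x n)"
      using assms(3)[of n "x n"] by (simp add: is_arg_max_linorder)
  qed simp
  have near: "\<bar>g n u + u\<^sup>2 / 2\<bar> \<le> \<delta> n * u\<^sup>2 / 6" if "\<bar>u\<bar> < r n / \<sigma> n" for n u
  proof -
    have u: "\<sigma> n * \<bar>u\<bar> < r n"
      using that \<sigma>_pos[of n] by (simp add: field_simps)
    \<comment> \<open>A remainder bound at one point of the interval other than \<open>x n\<close> forces its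
      constant to be nonnegative.\<close>
    have "0 \<le> \<eta> n / 6 * \<bar>(x n + r n / 2) - x n\<bar> ^ 3"
      unfolding assms(7)
      by (rule order_trans[OF abs_ge_zero taylor_quadratic_remainder[OF assms(1) crit]])
        (use assms(5)[of n] in simp)
    then have "\<eta> n \<ge> 0"
      using assms(5)[of n] by (simp add: zero_le_mult_iff)
    have "?D2 n / 2 * (\<sigma> n * u)\<^sup>2 = - (u\<^sup>2 / 2)"
      using arg_cong[OF \<sigma>_sq[of n], of "\<lambda>z. z * u\<^sup>2 / 2"] by (simp add: power_mult_distrib mult.assoc)
    then have "\<bar>g n u + u\<^sup>2 / 2\<bar> \<le> \<eta> n / 6 * \<bar>\<sigma> n * u\<bar> ^ 3"
      using taylor_quadratic_remainder[OF assms(1)[of n] crit[of n], where y = "x n + \<sigma> n * u" and r = "r n"]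
        u \<sigma>_pos[of n]
      by (simp add: assms(7) g_def abs_mult)
    also have "\<dots> = \<eta> n / 6 * (\<sigma> n)\<^sup>2 * u\<^sup>2 * (\<sigma> n * \<bar>u\<bar>)"
      using \<sigma>_pos[of n] by (simp add: abs_mult power3_eq_cube power2_eq_square)
    also have "\<dots> \<le> \<eta> n / 6 * (\<sigma> n)\<^sup>2 * u\<^sup>2 * r n"
      using u \<open>\<eta> n \<ge> 0\<close> by (intro mult_left_mono) auto
    finally show ?thesis by (simp add: assms(8) mult_ac)
  qed
  have lim: "(\<lambda>n. LINT u:A n|lborel. exp (g n u)) \<longlonglongrightarrow> sqrt (2 * pi)"
  proof (rule rescaled_laplace_limit[OF _ _ near assms(9,10)])
    show "A n \<in> sets borel" for n
      using measurable_sets_borel[of "\<lambda>u. x n + \<sigma> n * u" borel I]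
        real_interval_borel_measurable[OF assms(11)]
      by (simp add: A_def vimage_def)
    show "concave_on UNIV (g n)" for n
      unfolding g_def by (rule concave_on_rescale[OF assms(2)])
    show "\<forall>\<^sub>F n in sequentially. {- (r n / \<sigma> n)<..<r n / \<sigma> n} \<subseteq> A n"
      using assms(12)
    proof eventually_elim
      case (elim n)
      show ?case
      proof
        fix u assume "u \<in> {- (r n / \<sigma> n)<..<r n / \<sigma> n}"
        then have "x n + \<sigma> n * u \<in> {x n - r n<..<x n + r n}"
          using \<sigma>_pos[of n] by (simp add: field_simps)
        with elim show "u \<in> A n" by (auto simp: A_def)
      qed
    qed
  qed
  have "(LINT t:I|lborel. exp (F n t)) / (sqrt (2 * pi / (- ?D2 n)) * exp (F n (x n)))
      = (LINT u:A n|lborel. exp (g n u)) / sqrt (2 * pi)" for n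
  proof -
    have "sqrt (2 * pi / (- ?D2 n)) = sqrt (2 * pi) * \<sigma> n"
      unfolding assms(6) real_sqrt_mult[symmetric] by simp
    then show ?thesis
      using \<sigma>_pos[of n] set_integral_exp_rescale[OF \<sigma>_pos, of I "F n" n "x n"]
      by (simp add: A_def g_def)
  qed
  with tendsto_divide[OF lim tendsto_const[of "sqrt (2 * pi)"]]
  show ?thesis
    by (intro asymp_equivI') simp
qed

end
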